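(* Let $K\subset\mathbb{R}^n$ be a smooth convex body containing the origin $o$ in its interior. Let $P$ be a projective transformation, defined on $K$, that maps each line passing through $o$ to itself, fixing $o$ and preserving the orientation of the line at $o$, and suppose that the image $T=P(K)$ is a convex body. Then the billiard reflection law in the space $\mathbb{R}^n$ with norm $\|\cdot\|_K$ is the same as in the space $\mathbb{R}^n$ with norm $\|\cdot\|_T$. That is, for every smooth hypersurface $S\subset\mathbb{R}^n$, every point $q_2\in S$ and all points $q_1,q_3\in\mathbb{R}^n\setminus\{q_2\}$, the path $q_1q_2q_3$ satisfies the billiard reflection law at $q_2$ on $S$ with respect to $\|\cdot\|_K$ if and only if it satisfies the billiard reflection law at $q_2$ on $S$ with respect to $\|\cdot\|_T$.
   Context: A convex body is a compact convex set with nonempty interior; it is smooth if it has a unique supporting hyperplane at each boundary point. For a convex body $K\subset\mathbb{R}^n$ containing the origin $o$ in its interior, $\|\cdot\|_K$ denotes the (not necessarily symmetric) norm with unit ball $K$, i.e. $\|x\|_K=\inf\{\lambda>0 : x\in\lambda K\}$. In general $\|x\|_K\neq\|-x\|_K$. When $K$ is smooth, $\|\cdot\|_K$ is differentiable on $\mathbb{R}^n\setminus\{o\}$. A projective transformation is one of the real projective space containing $\mathbb{R}^n$ as an affine chart; it is defined on $K$ if no point of $K$ is sent to infinity. Preserving the orientation of a line $\ell$ through $o$ at $o$ means that the restriction of $P$ to $\ell$ near $o$ is orientation preserving (its derivative at $o$ is positive). Billiard reflection law: let $\|\cdot\|=\|\cdot\|_L$ be the (not necessarily symmetric) norm $\|x\|_L=\inf\{\lambda>0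 : x\in\lambda L\}$ whose unit ball $L\subset\mathbb{R}^n$ is a smooth convex body containing the origin $o$ in its interior, $S$ a smooth hypersurface, $q_2\in S$, and $q_1,q_3\ne q_2$. The path $q_1q_2q_3$ (moving along the segment from $q_1$ to $q_2$, then along the segment from $q_2$ to $q_3$) satisfies the billiard reflection law at $q_2$ on $S$ with respect to $\|\cdot\|$ if $q_2$ is a critical point of the function $x\mapsto \|x-q_1\|+\|q_3-x\|$ restricted to $x\in S$. If the unit ball is not strictly convex, the reflected direction need not be uniquely determined by the incoming one; the reflection law is understood as this relation between incoming and outgoing directions. *)

theory Defs
  imports "HOL-Analysis.Analysis"
begin

section \<open>Convex bodies and the norms they define\<close>

definition convex_body :: "(real^'n) set \<Rightarrow> bool" where
  "convex_body K \<longleftrightarrow> compact K \<and> convex K \<and> interior K \<noteq> {}"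

definition supporting_hyperplane :: "(real^'n) set \<Rightarrow> real^'n \<Rightarrow> (real^'n) set \<Rightarrow> bool" where
  "supporting_hyperplane K x H \<longleftrightarrow>
     (\<exists>a. a \<noteq> 0 \<and> H = {y. a \<bullet> y = a \<bullet> x} \<and> (\<forall>y\<in>K. a \<bullet> y \<le> a \<bullet> x))"

definition smooth_convex_body :: "(real^'n) set \<Rightarrow> bool" where
  "smooth_convex_body K \<longleftrightarrow>
     convex_body K \<and> (\<forall>x\<in>frontier K. \<exists>!H. supporting_hyperplane K x H)"

definition body_norm :: "(real^'n) set \<Rightarrow> real^'n \<Rightarrow> real" where
  "body_norm K x = Inf {l. l > 0 \<and> x \<in> (\<lambda>y. l *\<^sub>R y) ` K}"


section \<open>Projective transformations\<close>

text \<open>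
  The points of the projective space of a vector space are its one-dimensional subspaces.
  The projective completion of \<open>\<real>\<^sup>n\<close> is the projective space of \<open>\<real>\<^sup>n \<times> \<real>\<close>, with affine chart
  \<open>x \<mapsto> [x : 1]\<close>; the points at infinity are the lines spanned by vectors \<open>(v, 0)\<close>.
\<close>

definition proj_points :: "'v::real_vector set set" where
  "proj_points = {span {z} |z. z \<noteq> 0}"

text \<open>Only the values of \<open>P\<close> on \<open>proj_points\<close> are meaningful.\<close>

definition projective_transformation :: "('v::real_vector set \<Rightarrow> 'v set) \<Rightarrow> bool" where
  "projective_transformation P \<longleftrightarrow>
     (\<exists>F. linear F \<and> bij F \<and> (\<forall>p\<in>proj_points. P p = F ` p))"

definition chart :: "real^'n \<Rightarrow> ((real^'n) \<times> real) set" where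
  "chart x = span {(x, 1)}"

definition defined_on ::
    "(((real^'n) \<times> real) set \<Rightarrow> ((real^'n) \<times> real) set) \<Rightarrow> (real^'n) set \<Rightarrow> bool" where
  "defined_on P K \<longleftrightarrow> (\<forall>x\<in>K. P (chart x) \<in> range chart)"

text \<open>The expression of \<open>P\<close> in the affine chart, meaningful at \<open>x\<close> if \<open>P\<close> is defined on \<open>{x}\<close>.\<close>

definition affine_part ::
    "(((real^'n) \<times> real) set \<Rightarrow> ((real^'n) \<times> real) set) \<Rightarrow> real^'n \<Rightarrow> real^'n" where
  "affine_part P x = (THE y. P (chart x) = chart y)"

text \<open>
  The projective line, including its point at infinity, that completes the line through the
  origin with direction \<open>v \<noteq> 0\<close>.
\<close>

definition proj_line :: "real^'n \<Rightarrow> ((real^'n) \<times> real) set set" where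
  "proj_line v = {p \<in> proj_points. p \<subseteq> span {v} \<times> UNIV}"

definition preserves_orientation_at_origin ::
    "(((real^'n) \<times> real) set \<Rightarrow> ((real^'n) \<times> real) set) \<Rightarrow> real^'n \<Rightarrow> bool" where
  "preserves_orientation_at_origin P v \<longleftrightarrow>
     (\<exists>d>0. ((\<lambda>t. affine_part P (t *\<^sub>R v)) has_vector_derivative (d *\<^sub>R v)) (at 0))"


section \<open>Billiard reflection\<close>

text \<open>
  ``Smooth'' means continuously differentiable, in accordance with the use of the word for
  convex bodies; every hypersurface of class \<open>C\<^sup>k\<close>, for \<open>1 \<le> k \<le> \<infinity>\<close>, is included.
\<close>

definition smooth_hypersurface :: "(real^'n) set \<Rightarrow> bool" where
  "smooth_hypersurface S \<longleftrightarrow>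
     (\<forall>p\<in>S. \<exists>U g G. open U \<and> p \<in> U \<and>
        (\<forall>x\<in>U. (g has_derivative (\<lambda>h. G x \<bullet> h)) (at x) \<and> G x \<noteq> 0) \<and>
        continuous_on U G \<and> S \<inter> U = {x\<in>U. g x = (0::real)})"

text \<open>
  The differential of the restriction of \<open>f\<close> to \<open>S\<close> vanishes at \<open>q\<close>: the derivative of \<open>f\<close>
  along every curve in \<open>S\<close> through \<open>q\<close> is zero.
\<close>

definition critical_point_on :: "(real^'n) set \<Rightarrow> (real^'n \<Rightarrow> real) \<Rightarrow> real^'n \<Rightarrow> bool" where
  "critical_point_on S f q \<longleftrightarrow> q \<in> S \<and>
     (\<forall>\<gamma> e. e > 0 \<and> \<gamma> C1_differentiable_on {-e<..<e} \<and> \<gamma> ` {-e<..<e} \<subseteq> S \<and> \<gamma> 0 = q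
        \<longrightarrow> ((\<lambda>t. f (\<gamma> t)) has_real_derivative 0) (at 0))"

definition billiard_reflection ::
    "(real^'n) set \<Rightarrow> (real^'n) set \<Rightarrow> real^'n \<Rightarrow> real^'n \<Rightarrow> real^'n \<Rightarrow> bool" where
  "billiard_reflection L S q1 q2 q3 \<longleftrightarrow>
     critical_point_on S (\<lambda>x. body_norm L (x - q1) + body_norm L (q3 - x)) q2"

end

theory Submission
  imports Defs
begin

text \<open>
  In homogeneous coordinates \<open>P\<close> is given by a linear map preserving every plane
  \<open>span {v} \<times> \<real>\<close> and the axis \<open>{0} \<times> \<real>\<close>. All vectors are then eigenvectors of its \<open>\<real>\<^sup>n\<close>-block,
  so in the affine chart \<open>P x = a x / (1 + b x)\<close> with a linear functional \<open>b\<close> and, by the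
  orientation condition, \<open>a > 0\<close>. For maps of this form \<open>\<parallel>x\<parallel>\<^sub>T = (\<parallel>x\<parallel>\<^sub>K + b x) / a\<close>. Hence the
  length functions \<open>\<parallel>x - q1\<parallel> + \<parallel>q3 - x\<parallel>\<close> for \<open>K\<close> and \<open>T\<close> differ by a positive factor and the
  constant \<open>b (q3 - q1) / a\<close>, and they have the same critical points.
\<close>

section \<open>Linear maps for which every vector is an eigenvector\<close>

text \<open>Fix \<open>u\<close> nonzero. If \<open>v\<close> is not a multiple of \<open>u\<close>,
  comparing \<open>A (u + v)\<close> with \<open>A u + A v\<close> forces the eigenvalues of
  \<open>u\<close>, \<open>v\<close> and \<open>u + v\<close> to agree.\<close>

lemma linear_eigen_imp_scalar:
  fixes A :: "'a::real_vector \<Rightarrow> 'a"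
  assumes A: "linear A" and eigen: "\<And>v. \<exists>c. A v = c *\<^sub>R v"
  obtains c where "\<And>v. A v = c *\<^sub>R v"
proof (cases "\<exists>u::'a. u \<noteq> 0")
  case False
  then have "A v = 0 *\<^sub>R v" for v
    by metis
  then show ?thesis
    by (rule that)
next
  case True
  then obtain u :: 'a where u: "u \<noteq> 0"
    by blast
  obtain c where c: "A u = c *\<^sub>R u"
    using eigen by blast
  have "A v = c *\<^sub>R v" for v
  proof (cases "\<exists>k. v = k *\<^sub>R u")
    case True
    then show ?thesis
      using c by (auto simp: linear_scale[OF A])
  next
    case False
    obtain d where d: "A v = d *\<^sub>R v"
      using eigen by blast
    obtain e where e: "A (u + v) = e *\<^sub>R (u + v)"
      using eigen by blast
    have eq: "(d - e) *\<^sub>R v = (e - c) *\<^sub>R u"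
      using e c d by (simp add: linear_add[OF A] algebra_simps)
    have "d = e"
    proof (rule ccontr)
      assume "d \<noteq> e"
      then have "v = inverse (d - e) *\<^sub>R ((d - e) *\<^sub>R v)"
        by simp
      then have "v = (inverse (d - e) * (e - c)) *\<^sub>R u"
        unfolding eq by simp
      with False show False
        by blast
    qed
    with eq u d show ?thesis
      by simp
  qed
  then show ?thesis
    by (rule that)
qed

section \<open>Homogeneous coordinates\<close>

lemma chart_inject: "chart x = chart y \<longleftrightarrow> x = y"
proof
  assume "chart x = chart y"
  then have "(x, 1) \<in> span {(y, 1::real)}"
    unfolding chart_def using span_base[of "(x, 1::real)" "{(x, 1)}"] by simp
  then show "x = y"
    by (auto simp: span_singleton)
qed simp

text \<open>Dehomogenization: dividing by the last coordinate \<open>s\<close> recovers the affine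
  point, and \<open>s = 0\<close> means a point at infinity.\<close>

lemma span_Pair_eq_chart_iff:
  "span {(y, s)} = chart z \<longleftrightarrow> s \<noteq> 0 \<and> z = y /\<^sub>R s"
proof -
  have scale: "span {(y, s)} = chart (y /\<^sub>R s)" if "s \<noteq> 0"
  proof -
    have "(y, s) = s *\<^sub>R (y /\<^sub>R s, 1)"
      using that by simp
    then show ?thesis
      unfolding chart_def using that span_image_scale[of "{(y /\<^sub>R s, 1::real)}" "\<lambda>_. s"] by simp
  qed
  moreover have "s \<noteq> 0" if "span {(y, s)} = chart z"
  proof -
    have "(z, 1) \<in> span {(y, s)}"
      unfolding that chart_def by (simp add: span_base)
    then show ?thesis
      by (auto simp: span_singleton)
  qed
  ultimately show ?thesis
    by (auto simp: chart_inject)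
qed

lemma affine_part_linear_image:
  assumes F: "linear F" and P: "\<forall>p\<in>proj_points. P p = F ` p"
    and Fx: "F (x, 1) = (y, s)"
  shows "P (chart x) \<in> range chart \<longleftrightarrow> s \<noteq> 0"
    and "s \<noteq> 0 \<Longrightarrow> affine_part P x = y /\<^sub>R s"
proof -
  have "chart x \<in> proj_points"
    unfolding chart_def proj_points_def by (force simp: zero_prod_def)
  then have "P (chart x) = F ` span {(x, 1)}"
    using P by (simp add: chart_def)
  also have "\<dots> = span {(y, s)}"
    using Fx by (simp add: linear_span_image[OF F, symmetric])
  finally have *: "P (chart x) = span {(y, s)}" .
  show "P (chart x) \<in> range chart \<longleftrightarrow> s \<noteq> 0"
    unfolding * by (auto simp: image_iff span_Pair_eq_chart_iff)
  show "affine_part P x = y /\<^sub>R s" if "s \<noteq> 0"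
    unfolding affine_part_def * span_Pair_eq_chart_iff using that by simp
qed

section \<open>The affine form of \<open>P\<close>\<close>

text \<open>Otherwise the segment from 0 to \<open>x\<close>, which lies in \<open>K\<close>, would
  cross the hyperplane \<open>b = -1\<close>, where the denominator vanishes.\<close>

lemma linear_functional_gt_minus_one:
  fixes b :: "'a::real_vector \<Rightarrow> real"
  assumes "convex K" "0 \<in> K" "linear b" "\<And>x. x \<in> K \<Longrightarrow> 1 + b x \<noteq> 0" "x \<in> K"
  shows "1 + b x > 0"
proof (rule ccontr)
  assume "\<not> 1 + b x > 0"
  then have neg: "b x \<le> -1"
    by simp
  \<comment> \<open>The parameter at which the segment meets that hyperplane.\<close>
  define s where "s = -1 / b x"
  have s: "0 \<le> s" "s \<le> 1"
    using neg by (auto simp: s_def divide_simps)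
  have "(1 - s) *\<^sub>R 0 + s *\<^sub>R x \<in> K"
    using assms s by (intro convexD) auto
  then have "1 + b (s *\<^sub>R x) \<noteq> 0"
    using assms(4) by simp
  moreover have "b (s *\<^sub>R x) = -1"
    using neg unfolding linear_scale[OF assms(3)] s_def by simp
  ultimately show False
    by simp
qed

text \<open>Invariance of lines makes the block \<open>A\<close> scalar, fixing the origin removes
  the translation part, and the orientation gives the sign of \<open>a\<close>, since
  \<open>P\<close> has derivative \<open>a\<close> at the origin along every line.\<close>

lemma central_projective_form:
  fixes K :: "(real^'n) set"
  assumes K: "convex K" "0 \<in> K"
    and proj: "projective_transformation P" and def: "defined_on P K"
    and lines: "\<And>v. v \<noteq> 0 \<Longrightarrow> P ` proj_line v = proj_line v"
    and fix0: "P (chart 0) = chart 0"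
    and orient: "\<And>v. v \<noteq> 0 \<Longrightarrow> preserves_orientation_at_origin P v"
  obtains a b where "a > 0" "linear b" "\<And>x. x \<in> K \<Longrightarrow> 1 + b x > 0"
    "\<And>x. x \<in> K \<Longrightarrow> affine_part P x = (a / (1 + b x)) *\<^sub>R x"
proof -
  obtain F where F: "linear F" and P: "\<forall>p\<in>proj_points. P p = F ` p"
    using proj unfolding projective_transformation_def by blast
  define A where "A v = fst (F (v, 0))" for v
  define m where "m v = snd (F (v, 0))" for v
  have Pair0: "linear (\<lambda>v::real^'n. (v, 0::real))"
    by (rule linearI) auto
  have "linear (\<lambda>v. F (v, 0))"
    using linear_compose[OF Pair0 F] by (simp add: o_def)
  then have linA: "linear A" and linm: "linear m"
    unfolding A_def m_def
    using linear_compose[OF _ linear_fst] linear_compose[OF _ linear_snd]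
    by (force simp: o_def)+
  have "\<exists>c. A v = c *\<^sub>R v" for v
  proof (cases "v = 0")
    case True
    then show ?thesis
      using linear_0[OF linA] by simp
  next
    case False
    \<comment> \<open>The point at infinity of the line through \<open>v\<close>. Its image may be
      finite but stays on that projective line, so the first component of \<open>F (v, 0)\<close> is
      a multiple of \<open>v\<close>.\<close>
    let ?p = "span {(v, 0::real)}"
    have "?p \<in> proj_points"
      unfolding proj_points_def using False by (auto simp: zero_prod_def)
    then have "P ?p = F ` ?p" and "?p \<in> proj_line v"
      using P unfolding proj_line_def by (auto simp: span_singleton)
    then have "F ` ?p \<in> proj_line v"
      using imageI[of ?p "proj_line v" P] lines[OF False] by simp
    then have "F (v, 0) \<in> span {v} \<times> UNIV"
      unfolding proj_line_def by (auto intro: span_base)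
    then show ?thesis
      unfolding A_def by (auto simp: mem_Times_iff span_singleton)
  qed
  then obtain l where l: "\<And>v. A v = l *\<^sub>R v"
    using linear_eigen_imp_scalar[OF linA] by metis
  obtain y c where yc: "F (0, 1) = (y, c)"
    by fastforce
  \<comment> \<open>The origin is sent to a finite point.\<close>
  have c: "c \<noteq> 0"
    using affine_part_linear_image(1)[OF F P yc] fix0 by auto
  have y: "y = 0"
  proof -
    have "y /\<^sub>R c = affine_part P 0"
      using affine_part_linear_image(2)[OF F P yc c] by simp
    also have "\<dots> = 0"
      unfolding affine_part_def fix0 chart_inject by simp
    finally show ?thesis
      using c by simp
  qed
  have Fx: "F (x, 1) = (l *\<^sub>R x, m x + c)" for x
  proof -
    have "F (x, 1) = F (x, 0) + F (0, 1)"
      by (simp flip: linear_add[OF F])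
    also have "F (x, 0) = (A x, m x)"
      by (simp add: A_def m_def)
    finally show ?thesis
      by (simp add: yc y l)
  qed
  \<comment> \<open>Homogeneous coordinates are determined up to scale; dividing by \<open>c\<close>
    normalizes the denominator to 1 at the origin.\<close>
  define a where "a = l / c"
  define b where "b x = m x / c" for x
  have linb: "linear b"
    unfolding b_def using linm
    by (intro linearI) (simp_all add: linear_add linear_scale add_divide_distrib)
  have aff: "affine_part P x = (a / (1 + b x)) *\<^sub>R x" if "1 + b x \<noteq> 0" for x
  proof -
    have eq: "m x + c = c * (1 + b x)"
      using c by (simp add: b_def distrib_left)
    then have "m x + c \<noteq> 0"
      using that c by simp
    from affine_part_linear_image(2)[OF F P Fx this] show ?thesis
      unfolding eq by (simp add: a_def divide_simps)
  qed
  have ne: "1 + b x \<noteq> 0" if "x \<in> K" for x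
  proof -
    have "m x + c \<noteq> 0"
      using def that affine_part_linear_image(1)[OF F P Fx[of x]]
      unfolding defined_on_def by blast
    moreover have "m x + c = c * (1 + b x)"
      using c by (simp add: b_def distrib_left)
    ultimately show ?thesis
      by auto
  qed
  have "a > 0"
  proof -
    \<comment> \<open>Index types are nonempty, so a coordinate vector at any index serves as a
      nonzero direction.\<close>
    obtain v :: "real^'n" where v: "v \<noteq> 0"
      using axis_eq_0_iff[of undefined "1::real"] zero_neq_one by blast
    then obtain d where d: "d > 0"
      and dv: "((\<lambda>t. affine_part P (t *\<^sub>R v)) has_vector_derivative (d *\<^sub>R v)) (at 0)"
      using orient unfolding preserves_orientation_at_origin_def by blast
    have "((\<lambda>t. 1 + t * b v) \<longlongrightarrow> 1 + 0 * b v) (at 0)"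
      by (intro tendsto_intros)
    then have "\<forall>\<^sub>F t in at 0. 1 + t * b v \<noteq> 0"
      by (rule tendsto_imp_eventually_ne) simp
    then have ev: "\<forall>\<^sub>F t in at 0. affine_part P (t *\<^sub>R v) = (a * t / (1 + t * b v)) *\<^sub>R v"
      by eventually_elim (simp add: aff linear_scale[OF linb] mult.commute)
    have "((\<lambda>t. a * t / (1 + t * b v)) has_real_derivative a) (at 0)"
      by (auto intro!: derivative_eq_intros)
    then have "((\<lambda>t. (a * t / (1 + t * b v)) *\<^sub>R v) has_vector_derivative a *\<^sub>R v) (at 0)"
      using has_vector_derivative_scaleR[OF _ has_vector_derivative_const[of v]] by force
    then have "((\<lambda>t. affine_part P (t *\<^sub>R v)) has_vector_derivative a *\<^sub>R v) (at 0)"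
      unfolding has_vector_derivative_def
    proof (rule has_derivative_transform_eventually)
      show "\<forall>\<^sub>F t in at 0. (a * t / (1 + t * b v)) *\<^sub>R v = affine_part P (t *\<^sub>R v)"
        using ev by eventually_elim simp
      show "(a * 0 / (1 + 0 * b v)) *\<^sub>R v = affine_part P (0 *\<^sub>R v)"
        using aff[of 0] linear_0[OF linb] by simp
    qed simp
    from vector_derivative_unique_at[OF this dv] v d show ?thesis
      by simp
  qed
  show thesis
  proof (rule that[OF \<open>a > 0\<close> linb])
    fix x
    assume x: "x \<in> K"
    show "1 + b x > 0"
      by (rule linear_functional_gt_minus_one[OF K linb ne x])
    show "affine_part P x = (a / (1 + b x)) *\<^sub>R x"
      by (rule aff[OF ne[OF x]])
  qed
qed

section \<open>Norms and critical points\<close>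

text \<open>If \<open>x = r *\<^sub>R k\<close> with \<open>k\<close> in \<open>K\<close>, then
  \<open>x\<close> is \<open>r * (1 + b k) / a\<close> times the image of \<open>k\<close>, and
  \<open>r * b k = b x\<close>. Thus the admissible scaling factors for the two bodies correspond
  under the increasing map taking \<open>r\<close> to \<open>(r + b x) / a\<close>, which commutes
  with infima.\<close>

lemma body_norm_central_projective_image:
  fixes K :: "(real^'n) set"
  assumes K: "0 \<in> interior K" and a: "a > 0" and b: "linear b"
    and pos: "\<And>x. x \<in> K \<Longrightarrow> 1 + b x > 0"
  shows "body_norm ((\<lambda>x. (a / (1 + b x)) *\<^sub>R x) ` K) x = (body_norm K x + b x) / a"
proof -
  let ?f = "\<lambda>x. (a / (1 + b x)) *\<^sub>R x"
  define N where "N L = {l. l > 0 \<and> x \<in> (\<lambda>y. l *\<^sub>R y) ` L}" for L :: "(real^'n) set"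
  have "N (?f ` K) = (\<lambda>r. (r + b x) / a) ` N K"
  proof (intro set_eqI iffI)
    fix l
    assume "l \<in> N (?f ` K)"
    then obtain k where k: "k \<in> K" "x = (l * a / (1 + b k)) *\<^sub>R k" and l: "l > 0"
      by (auto simp: N_def)
    define r where "r = l * a / (1 + b k)"
    have r: "r > 0" "x = r *\<^sub>R k"
      using a l pos[OF k(1)] k(2) by (simp_all only: r_def divide_pos_pos mult_pos_pos)
    then have "r \<in> N K"
      using k(1) unfolding N_def by blast
    moreover have "l = (r + b x) / a"
    proof -
      have "b x = r * b k"
        using r(2) by (simp add: linear_scale[OF b])
      then have "r + b x = r * (1 + b k)"
        by (simp add: algebra_simps)
      then show ?thesis
        using a pos[OF k(1)] by (simp add: r_def)
    qed
    ultimately show "l \<in> (\<lambda>r. (r + b x) / a) ` N K"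
      by (intro image_eqI)
  next
    fix l
    assume "l \<in> (\<lambda>r. (r + b x) / a) ` N K"
    then obtain r k where r: "r > 0" "l = (r + b x) / a" and k: "k \<in> K" "x = r *\<^sub>R k"
      by (auto simp: N_def)
    have l: "l = r * (1 + b k) / a"
      using r k by (simp add: linear_scale[OF b] algebra_simps)
    have "x = l *\<^sub>R ?f k"
      unfolding l k(2) using a pos[OF k(1)] by simp
    moreover have "l > 0"
      using l a r pos[OF k(1)] by simp
    ultimately show "l \<in> N (?f ` K)"
      using k(1) unfolding N_def by blast
  qed
  also have "Inf \<dots> = (Inf (N K) + b x) / a"
  proof (rule continuous_at_Inf_mono[symmetric])
    show "mono (\<lambda>r. (r + b x) / a)"
      using a by (auto intro!: monoI divide_right_mono)
    show "continuous (at_right (Inf (N K))) (\<lambda>r. (r + b x) / a)"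
      using a by (intro continuous_intros) auto
    show "bdd_below (N K)"
      by (rule bdd_belowI[of _ 0]) (auto simp: N_def)
    obtain e where e: "e > 0" "ball 0 e \<subseteq> K"
      using K unfolding mem_interior by blast
    \<comment> \<open>This factor shrinks \<open>x\<close> into the ball of radius \<open>e\<close>
      inside \<open>K\<close>; the summand 1 keeps it positive at \<open>x = 0\<close> and the norm
      bound strict.\<close>
    define r where "r = (norm x + 1) / e"
    have r: "r > 0"
      using e by (simp add: r_def add_nonneg_pos)
    have "norm (x /\<^sub>R r) = e * (norm x / (norm x + 1))"
      using e r by (simp add: r_def field_simps)
    also have "\<dots> < e * 1"
      using e by (intro mult_strict_left_mono) (auto simp: divide_less_eq add_nonneg_pos)
    finally have "x /\<^sub>R r \<in> K"
      using e by auto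
    then have "r \<in> N K"
      using r by (auto simp: N_def intro!: image_eqI[of _ _ "x /\<^sub>R r"])
    then show "N K \<noteq> {}"
      by blast
  qed
  finally show ?thesis
    by (simp add: body_norm_def N_def)
qed

lemma critical_point_on_affine:
  assumes "critical_point_on S f q"
  shows "critical_point_on S (\<lambda>x. k * f x + c) q"
  unfolding critical_point_on_def
proof (intro conjI allI impI)
  show "q \<in> S"
    using assms by (simp add: critical_point_on_def)
  fix \<gamma> :: "real \<Rightarrow> real^'a" and e :: real
  assume "0 < e \<and> \<gamma> C1_differentiable_on {-e<..<e} \<and> \<gamma> ` {-e<..<e} \<subseteq> S \<and> \<gamma> 0 = q"
  then have "((\<lambda>t. f (\<gamma> t)) has_real_derivative 0) (at 0)"
    using assms unfolding critical_point_on_def by blast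
  then show "((\<lambda>t. k * f (\<gamma> t) + c) has_real_derivative 0) (at 0)"
    by (auto intro!: derivative_eq_intros)
qed

theorem theorem3:
  fixes K T :: "(real^'n) set"
    and P :: "((real^'n) \<times> real) set \<Rightarrow> ((real^'n) \<times> real) set"
  assumes "smooth_convex_body K" and "0 \<in> interior K"
    and "projective_transformation P" and "defined_on P K"
    and "\<And>v. v \<noteq> 0 \<Longrightarrow> P ` proj_line v = proj_line v"
    and "P (chart 0) = chart 0"
    and "\<And>v. v \<noteq> 0 \<Longrightarrow> preserves_orientation_at_origin P v"
    and "T = affine_part P ` K" and "convex_body T"
  shows "\<forall>S q1 q2 q3. smooth_hypersurface S \<and> q2 \<in> S \<and> q1 \<noteq> q2 \<and> q3 \<noteq> q2 \<longrightarrow>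
           (billiard_reflection K S q1 q2 q3 \<longleftrightarrow> billiard_reflection T S q1 q2 q3)"
proof -
  have K: "convex K" "0 \<in> K"
    using assms(1,2) interior_subset
    by (auto simp: smooth_convex_body_def convex_body_def)
  obtain a b where a: "a > 0" and b: "linear b"
    and pos: "\<And>x. x \<in> K \<Longrightarrow> 1 + b x > 0"
    and aff: "\<And>x. x \<in> K \<Longrightarrow> affine_part P x = (a / (1 + b x)) *\<^sub>R x"
    using central_projective_form[OF K assms(3-7)] by blast
  have T: "T = (\<lambda>x. (a / (1 + b x)) *\<^sub>R x) ` K"
    unfolding assms(8) using aff by (rule image_cong[OF refl])
  have norm_T: "body_norm T x = (body_norm K x + b x) / a" for x
    unfolding T by (rule body_norm_central_projective_image[OF assms(2) a b pos])
  have "billiard_reflection K S q1 q2 q3 \<longleftrightarrow> billiard_reflection T S q1 q2 q3" for S q1 q2 q3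
  proof -
    let ?f = "\<lambda>L x. body_norm L (x - q1) + body_norm L (q3 - x)"
    \<comment> \<open>The contributions \<open>b (x - q1)\<close> and \<open>b (q3 - x)\<close> add
      up to a quantity independent of \<open>x\<close>.\<close>
    have "?f T x = (?f K x + b (q3 - q1)) / a" for x
      by (simp add: norm_T linear_diff[OF b] flip: add_divide_distrib)
    then have eq: "?f T = (\<lambda>x. 1 / a * ?f K x + b (q3 - q1) / a)"
      by (simp add: add_divide_distrib)
    \<comment> \<open>Inverting the affine relation yields the converse implication.\<close>
    have eq': "?f K = (\<lambda>x. a * ?f T x + - b (q3 - q1))"
      using a by (intro ext) (simp add: fun_cong[OF eq] distrib_left)
    have "critical_point_on S (?f T) q2" if "critical_point_on S (?f K) q2"
      unfolding eq by (rule critical_point_on_affine[OF that])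
    moreover have "critical_point_on S (?f K) q2" if "critical_point_on S (?f T) q2"
      unfolding eq' by (rule critical_point_on_affine[OF that])
    ultimately show ?thesis
      unfolding billiard_reflection_def by blast
  qed
  then show ?thesis
    by blast
qed

end
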